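(* Let $k\geq 2$ be an integer. There exist positive constants $c$ and $C$ such that for all twice differentiable functions $f$ on $\partial\Omega_k$, $$|f(\mathbf y)-P_{\mathbf x}(\mathbf y-\mathbf x)|\le C\,d_{cc}(\mathbf x,\mathbf y)^2\sup_{\substack{d_{cc}(\mathbf x,\mathbf z)\le c\,d_{cc}(\mathbf x,\mathbf y)\\ i,j=1,2}}|X_iX_jf(\mathbf z)|$$ for all $\mathbf x,\mathbf y\in\partial\Omega_k$, where $P_{\mathbf x}(\mathbf y-\mathbf x)=f(\mathbf x)+(y_1-x_1)X_1f(\mathbf x)+(y_2-x_2)X_2f(\mathbf x)$ and $d_{cc}$ is the Carnot--Carathéodory distance on $\partial\Omega_k$.
   Context: $\partial\Omega_k=\{(z,w)\in\mathbb C^2:\operatorname{Im}(w)=\frac1{2k}|z|^{2k}\}$ is identified with $\mathbb C\times\mathbb R\cong\mathbb R^3$ via $z=x_1+ix_2$, $t=\operatorname{Re}(w)$; points are written $\mathbf x=(x_1,x_2,t)$, and the first two coordinates of $\mathbf y$ are $y_1,y_2$. The horizontal vector fields are $X_1=\partial_{x_1}+x_2(x_1^2+x_2^2)^{k-1}\partial_t$ and $X_2=\partial_{x_2}-x_1(x_1^2+x_2^2)^{k-1}\partial_t$. An absolutely continuous curve $\gamma$ is horizontal if $\dot\gamma(s)\in\mathrm{span}\{X_1(\gamma(s)),X_2(\gamma(s))\}$ for a.e. $s$. With $\|c_1X_1+c_2X_2\|_{cc}:=\sqrt{c_1^2+c_2^2}$, the Carnot--Carathéodory distance $d_{cc}(\mathbf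 x,\mathbf y)$ is the infimum of all $\tau$ for which there is a horizontal curve $\gamma:[0,\tau]\to\partial\Omega_k$ with $\|\dot\gamma(s)\|_{cc}\le1$ for $s\in[0,\tau]$, $\gamma(0)=\mathbf x$, $\gamma(\tau)=\mathbf y$. *)

theory Defs
  imports "HOL-Analysis.Analysis"
begin

text \<open>
  The boundary \<open>Im w = |z|\<^sup>2\<^sup>k / (2k)\<close> is a graph over \<open>(z, Re w)\<close>. Throughout it is represented by
  \<open>real ^ 3\<close>, with \<open>p $ 1 = Re z\<close>, \<open>p $ 2 = Im z\<close> and \<open>p $ 3 = Re w\<close>.
\<close>

definition X1 :: "nat \<Rightarrow> real ^ 3 \<Rightarrow> real ^ 3" where
  "X1 k p = vector [1, 0, p $ 2 * ((p $ 1)\<^sup>2 + (p $ 2)\<^sup>2) ^ (k - 1)]"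

definition X2 :: "nat \<Rightarrow> real ^ 3 \<Rightarrow> real ^ 3" where
  "X2 k p = vector [0, 1, - (p $ 1) * ((p $ 1)\<^sup>2 + (p $ 2)\<^sup>2) ^ (k - 1)]"

text \<open>A vector field acting on a function as a first-order differential operator; only meaningful
  where the function is differentiable.\<close>

definition vf_deriv ::
  "(real ^ 3 \<Rightarrow> real ^ 3) \<Rightarrow> (real ^ 3 \<Rightarrow> 'b::real_normed_vector) \<Rightarrow> real ^ 3 \<Rightarrow> 'b" where
  "vf_deriv X f p = frechet_derivative f (at p) (X p)"

text \<open>Pointwise existence of the second Frechet derivative; it need not be continuous.\<close>

definition twice_differentiable ::
  "('a::real_normed_vector \<Rightarrow> 'b::real_normed_vector) \<Rightarrow> bool" where
  "twice_differentiable f \<longleftrightarrow>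
     (\<exists>f' :: 'a \<Rightarrow> 'a \<Rightarrow>\<^sub>L 'b.
        (\<forall>x. (f has_derivative blinfun_apply (f' x)) (at x)) \<and> (\<forall>x. f' differentiable (at x)))"

text \<open>Absolute continuity of curves (not to be confused with the library's
  \<^const>\<open>absolutely_continuous\<close>, which is about measures).\<close>

definition abs_continuous_on :: "real \<Rightarrow> real \<Rightarrow> (real \<Rightarrow> 'a::metric_space) \<Rightarrow> bool" where
  "abs_continuous_on \<alpha> \<beta> \<gamma> \<longleftrightarrow>
     (\<forall>e>0. \<exists>d>0. \<forall>n (a :: nat \<Rightarrow> real) b.
        (\<forall>i<n. \<alpha> \<le> a i \<and> a i \<le> b i \<and> b i \<le> \<beta>) \<and>
        disjoint_family_on (\<lambda>i. {a i<..<b i}) {..<n} \<and>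
        (\<Sum>i<n. b i - a i) < d
        \<longrightarrow> (\<Sum>i<n. dist (\<gamma> (a i)) (\<gamma> (b i))) < e)"

definition horizontal_curve :: "nat \<Rightarrow> real \<Rightarrow> (real \<Rightarrow> real ^ 3) \<Rightarrow> bool" where
  "horizontal_curve k \<tau> \<gamma> \<longleftrightarrow>
     abs_continuous_on 0 \<tau> \<gamma> \<and>
     (AE s in lebesgue. s \<in> {0..\<tau>} \<longrightarrow>
        (\<exists>v. (\<gamma> has_vector_derivative v) (at s) \<and> v \<in> span {X1 k (\<gamma> s), X2 k (\<gamma> s)}))"

text \<open>Well defined for horizontal \<open>v\<close>, since \<open>X1\<close> and \<open>X2\<close> are linearly independent at every
  point; unspecified for other \<open>v\<close>.\<close>

definition cc_norm :: "nat \<Rightarrow> real ^ 3 \<Rightarrow> real ^ 3 \<Rightarrow> real" where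
  "cc_norm k p v =
     (THE r. \<exists>c1 c2. v = c1 *\<^sub>R X1 k p + c2 *\<^sub>R X2 k p \<and> r = sqrt (c1\<^sup>2 + c2\<^sup>2))"

text \<open>The speed bound is imposed almost everywhere, as the velocity of an absolutely continuous
  curve exists only almost everywhere.\<close>

definition cc_dist :: "nat \<Rightarrow> real ^ 3 \<Rightarrow> real ^ 3 \<Rightarrow> real" where
  "cc_dist k x y =
     Inf {\<tau>. 0 \<le> \<tau> \<and>
        (\<exists>\<gamma>. horizontal_curve k \<tau> \<gamma> \<and>
             (AE s in lebesgue. s \<in> {0..\<tau>} \<longrightarrow>
                cc_norm k (\<gamma> s) (vector_derivative \<gamma> (at s)) \<le> 1) \<and>
             \<gamma> 0 = x \<and> \<gamma> \<tau> = y)}"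

definition horizontal_taylor ::
  "nat \<Rightarrow> (real ^ 3 \<Rightarrow> 'b::real_normed_vector) \<Rightarrow> real ^ 3 \<Rightarrow> real ^ 3 \<Rightarrow> 'b" where
  "horizontal_taylor k f x h =
     f x + (h $ 1) *\<^sub>R vf_deriv (X1 k) f x + (h $ 2) *\<^sub>R vf_deriv (X2 k) f x"

end

theory Submission
  imports Defs
begin

text \<open>
  Join \<open>x\<close> to \<open>y\<close> by a horizontal curve \<open>\<gamma>\<close> of speed at most 1 and duration \<open>\<tau> \<le> 2 d\<^sub>c\<^sub>c(x, y)\<close>. Every point of
  it lies within distance \<open>\<tau>\<close> of \<open>x\<close>, so if \<open>M\<close> is the supremum on the right-hand side for \<open>c = 2\<close>,
  then \<open>X\<^sub>i f \<circ> \<gamma>\<close> has derivative at most \<open>2 M\<close> almost everywhere and \<open>X\<^sub>i f\<close> varies by at most \<open>2 M \<tau>\<close>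
  along \<open>\<gamma>\<close>. Hence \<open>f - z\<^sub>1 X\<^sub>1 f(x) - z\<^sub>2 X\<^sub>2 f(x)\<close> has derivative at most \<open>4 M \<tau>\<close> along \<open>\<gamma>\<close>, and
  a second application of the mean value inequality gives the bound \<open>4 M \<tau>\<^sup>2\<close>.

  As \<open>X\<^sub>i f\<close> is differentiable but perhaps not locally Lipschitz, \<open>X\<^sub>i f \<circ> \<gamma>\<close> need not be absolutely
  continuous. It satisfies a Lipschitz condition at each single point, however, with a constant that
  depends on the point, and this makes the mean value inequality survive an exceptional null set.
\<close>

section \<open>Mean value inequalities with an exceptional null set\<close>

lemma tagged_division_of_realE:
  fixes a b :: real
  assumes "p tagged_division_of {a..b}" "(s, K) \<in> p"
  obtains u v where "K = {u..v}" "u \<le> s" "s \<le> v" "a \<le> u" "v \<le> b"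
    "Inf K = u" "Sup K = v" "measure lborel K = v - u"
proof -
  obtain u v where K: "K = cbox u v"
    using tagged_division_ofD(4)[OF assms] by blast
  have "s \<in> K" "K \<subseteq> {a..b}"
    using tagged_division_ofD(2,3)[OF assms] by blast+
  then show thesis
    using K by (intro that[of u v]) auto
qed

text \<open>
  Sum the increments of \<open>g\<close> over a fine tagged division: they are dominated by a Riemann sum of \<open>B\<close>.
\<close>

lemma has_integral_local_bound_with_exceptions:
  fixes g :: "real \<Rightarrow> 'b::real_normed_vector" and B :: "real \<Rightarrow> real"
  assumes "a \<le> b" and B: "(B has_integral I) {a..b}"
    and loc: "\<And>s. s \<in> {a..b} - N \<Longrightarrow>
      \<exists>d>0. \<forall>u\<in>{a..b}. \<bar>u - s\<bar> < d \<longrightarrow> norm (g u - g s) \<le> B s * \<bar>u - s\<bar>"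
    and B_nonneg: "\<And>s. s \<in> N \<Longrightarrow> 0 \<le> B s"
    and exc: "\<And>e. e > 0 \<Longrightarrow> \<exists>D. gauge D \<and> (\<forall>p. p tagged_division_of {a..b} \<and> D fine p \<longrightarrow>
      (\<Sum>(s, K)\<in>{(s, K) \<in> p. s \<in> N}. norm (g (Sup K) - g (Inf K))) \<le> e)"
  shows "norm (g b - g a) \<le> I"
proof (rule field_le_epsilon)
  fix e :: real
  assume "0 < e"
  then have e2: "e / 2 > 0"
    by simp
  obtain D1 where D1: "gauge D1"
    "\<And>p. p tagged_division_of {a..b} \<Longrightarrow> D1 fine p \<Longrightarrow>
      norm ((\<Sum>(x, K)\<in>p. measure lborel K *\<^sub>R B x) - I) < e / 2"
    using B e2 unfolding has_integral_real by meson
  from exc[OF e2] obtain D2 where "gauge D2 \<and> (\<forall>p. p tagged_division_of {a..b} \<and> D2 fine p \<longrightarrow>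
      (\<Sum>(s, K)\<in>{(s, K) \<in> p. s \<in> N}. norm (g (Sup K) - g (Inf K))) \<le> e / 2)" ..
  then have D2: "gauge D2"
    "\<And>p. p tagged_division_of {a..b} \<Longrightarrow> D2 fine p \<Longrightarrow>
      (\<Sum>(s, K)\<in>{(s, K) \<in> p. s \<in> N}. norm (g (Sup K) - g (Inf K))) \<le> e / 2"
    by simp_all
  have "\<exists>d>0. s \<in> {a..b} - N \<longrightarrow>
      (\<forall>u\<in>{a..b}. \<bar>u - s\<bar> < d \<longrightarrow> norm (g u - g s) \<le> B s * \<bar>u - s\<bar>)" for s
    using loc[of s] zero_less_one[where 'a = real] by blast
  then obtain d where "\<forall>s. d s > 0 \<and> (s \<in> {a..b} - N \<longrightarrow>
      (\<forall>u\<in>{a..b}. \<bar>u - s\<bar> < d s \<longrightarrow> norm (g u - g s) \<le> B s * \<bar>u - s\<bar>))"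
    by metis
  then have d: "\<And>s. d s > 0"
    "\<And>s u. s \<in> {a..b} - N \<Longrightarrow> u \<in> {a..b} \<Longrightarrow> \<bar>u - s\<bar> < d s \<Longrightarrow> norm (g u - g s) \<le> B s * \<bar>u - s\<bar>"
    by blast+
  \<comment> \<open>The three gauges act on different terms: \<open>D1\<close> brings the Riemann
    sum of \<open>B\<close> close to \<open>I\<close>, \<open>D2\<close> controls the intervals with
    tag in \<open>N\<close>, and the balls make the local bound available at the endpoints of all
    other intervals.\<close>
  have "gauge (\<lambda>x. (D1 x \<inter> D2 x) \<inter> ball x (d x))"
    by (intro gauge_Int D1(1) D2(1) gauge_ball_dependent) (auto simp: d)
  then obtain p where p: "p tagged_division_of {a..b}"
    and fine: "(\<lambda>x. (D1 x \<inter> D2 x) \<inter> ball x (d x)) fine p"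
    by (rule fine_division_exists_real)
  have fine1: "D1 fine p" and fine2: "D2 fine p" and fine3: "(\<lambda>x. ball x (d x)) fine p"
    using fine by (auto simp: fine_Int)
  have fin: "finite p"
    using p by blast
  let ?G = "\<lambda>(s, K). norm (g (Sup K) - g (Inf K))"
  let ?P = "{(s, K) \<in> p. s \<in> N}"
  have nonexc: "?G q \<le> (\<lambda>(s, K). measure lborel K *\<^sub>R B s) q" if "q \<in> p - ?P" for q
  proof -
    obtain s K where q: "q = (s, K)" "(s, K) \<in> p" "s \<notin> N"
      using \<open>q \<in> p - ?P\<close> by auto
    obtain u v where K: "K = {u..v}" "u \<le> s" "s \<le> v" "a \<le> u" "v \<le> b"
      "Inf K = u" "Sup K = v" "measure lborel K = v - u"
      using tagged_division_of_realE[OF p q(2)] .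
    have "K \<subseteq> ball s (d s)"
      using fine3 q(2) unfolding fine_def by blast
    moreover have "u \<in> K" "v \<in> K"
      using K by auto
    ultimately have "\<bar>u - s\<bar> < d s" "\<bar>v - s\<bar> < d s"
      by (auto simp: dist_real_def subset_iff)
    then have "norm (g u - g s) \<le> B s * \<bar>u - s\<bar>" "norm (g v - g s) \<le> B s * \<bar>v - s\<bar>"
      using d(2)[of s u] d(2)[of s v] K(2-5) q(3) by auto
    moreover have "norm (g v - g u) \<le> norm (g v - g s) + norm (g u - g s)"
      using dist_triangle2[of "g v" "g u" "g s"] by (simp add: dist_norm)
    \<comment> \<open>The tag lies between \<open>u\<close> and \<open>v\<close>, so the two
      one-sided bounds add up to \<open>B s * (v - u)\<close>, which is the term of the Riemann sum
      at this tag.\<close>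
    ultimately have "norm (g v - g u) \<le> B s * (v - s) + B s * (s - u)"
      using K by simp
    then show ?thesis
      using K q by (simp add: algebra_simps)
  qed
  have exc_nonneg: "0 \<le> (\<lambda>(s, K). measure lborel K *\<^sub>R B s) q" if "q \<in> ?P" for q
    using that B_nonneg by auto
  have "norm (g b - g a) = norm (\<Sum>(x, K)\<in>p. g (Sup K) - g (Inf K))"
    using additive_tagged_division_1[OF \<open>a \<le> b\<close> p, of g] by simp
  also have "\<dots> \<le> (\<Sum>q\<in>p. ?G q)"
    by (rule order_trans[OF norm_sum]) (simp add: case_prod_unfold)
  also have "\<dots> = (\<Sum>q\<in>?P. ?G q) + (\<Sum>q\<in>p - ?P. ?G q)"
    using sum.subset_diff[of ?P p ?G] fin by (auto simp: add.commute)
  also have "\<dots> \<le> e / 2 + (\<Sum>q\<in>p - ?P. (\<lambda>(s, K). measure lborel K *\<^sub>R B s) q)"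
    by (intro add_mono D2(2) p fine2 sum_mono nonexc)
  \<comment> \<open>Non-negativity of \<open>B\<close> on \<open>N\<close> allows the missing terms
    to be put back, which completes the Riemann sum.\<close>
  also have "\<dots> \<le> e / 2 + (\<Sum>q\<in>p. (\<lambda>(s, K). measure lborel K *\<^sub>R B s) q)"
    using fin by (intro add_left_mono sum_mono2 exc_nonneg) auto
  also have "\<dots> \<le> e / 2 + (I + e / 2)"
    using D1(2)[OF p fine1] unfolding real_norm_def real_scaleR_def by linarith
  finally show "norm (g b - g a) \<le> I + e"
    by simp
qed

text \<open>The gap \<open>B - norm v\<close> absorbs the error of the first-order
  approximation.\<close>

lemma has_vector_derivative_local_bound:
  fixes g :: "real \<Rightarrow> 'b::real_normed_vector"
  assumes "(g has_vector_derivative v) (at s)" "norm v < B"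
  shows "\<exists>d>0. \<forall>u. \<bar>u - s\<bar> < d \<longrightarrow> norm (g u - g s) \<le> B * \<bar>u - s\<bar>"
proof -
  obtain d where d: "d > 0"
    "\<And>u. norm (u - s) < d \<Longrightarrow> norm (g u - g s - (u - s) *\<^sub>R v) \<le> (B - norm v) * norm (u - s)"
    using assms unfolding has_vector_derivative_def has_derivative_at_alt
    by (metis diff_gt_0_iff_gt)
  have "norm (g u - g s) \<le> B * \<bar>u - s\<bar>" if "\<bar>u - s\<bar> < d" for u
  proof -
    have "norm (g u - g s) \<le> norm (g u - g s - (u - s) *\<^sub>R v) + norm ((u - s) *\<^sub>R v)"
      by (metis norm_triangle_sub add.commute)
    also have "\<dots> \<le> (B - norm v) * \<bar>u - s\<bar> + \<bar>u - s\<bar> * norm v"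
      using d(2)[of u] that by simp
    finally show ?thesis
      by (simp add: algebra_simps)
  qed
  then show ?thesis
    using d(1) by blast
qed

text \<open>A gauge integral ignores the values of its integrand on a negligible set. The bounding
  function may therefore equal the local Lipschitz constant at each point of \<open>N\<close>,
  however wildly it varies there, while its integral stays that of a constant slightly above
  \<open>M\<close>.\<close>

lemma mean_value_bound_pointwise_lipschitz:
  fixes g :: "real \<Rightarrow> 'b::real_normed_vector"
  assumes "a \<le> b" "negligible N"
    and der: "\<And>s. s \<in> {a..b} - N \<Longrightarrow> \<exists>v. (g has_vector_derivative v) (at s) \<and> norm v \<le> M"
    and lip: "\<And>s. s \<in> {a..b} \<Longrightarrow>
      \<exists>B. \<exists>d>0. \<forall>u\<in>{a..b}. \<bar>u - s\<bar> < d \<longrightarrow> norm (g u - g s) \<le> B * \<bar>u - s\<bar>"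
  shows "norm (g b - g a) \<le> M * (b - a)"
proof (rule field_le_epsilon)
  fix e :: real
  assume "e > 0"
  \<comment> \<open>The slack \<open>e'\<close> supplies the strict inequality behind the local
    bound off \<open>N\<close>. The summand 1 keeps the denominator positive when
    \<open>a = b\<close>.\<close>
  define e' where "e' = e / (b - a + 1)"
  have "e' > 0"
    using \<open>e > 0\<close> \<open>a \<le> b\<close> by (simp add: e'_def)
  obtain B0 where B0: "\<And>s. s \<in> {a..b} \<Longrightarrow>
      \<exists>d>0. \<forall>u\<in>{a..b}. \<bar>u - s\<bar> < d \<longrightarrow> norm (g u - g s) \<le> B0 s * \<bar>u - s\<bar>"
    using lip by metis
  define B where "B s = (if s \<in> N then B0 s else M + e')" for s
  have "((\<lambda>_. M + e') has_integral (M + e') * (b - a)) {a..b}"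
    using has_integral_const_real[of "M + e'" a b] \<open>a \<le> b\<close> by (simp add: mult.commute)
  then have "(B has_integral (M + e') * (b - a)) {a..b}"
    by (rule has_integral_spike[OF \<open>negligible N\<close>, rotated]) (auto simp: B_def)
  then have "norm (g b - g a) \<le> (M + e') * (b - a)"
  \<comment> \<open>\<open>B\<close> bounds the increments of \<open>g\<close> near every point,
    those of \<open>N\<close> included, so the set of exceptional tags is empty here.\<close>
  proof (rule has_integral_local_bound_with_exceptions[OF \<open>a \<le> b\<close>, where N = "{}"])
    fix s
    assume s: "s \<in> {a..b} - {}"
    show "\<exists>d>0. \<forall>u\<in>{a..b}. \<bar>u - s\<bar> < d \<longrightarrow> norm (g u - g s) \<le> B s * \<bar>u - s\<bar>"
    proof (cases "s \<in> N")
      case True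
      then show ?thesis
        using B0[of s] s by (simp add: B_def)
    next
      case False
      then obtain v where v: "(g has_vector_derivative v) (at s)" "norm v \<le> M"
        using der s by blast
      have "norm v < M + e'"
        using v(2) \<open>e' > 0\<close> by simp
      from has_vector_derivative_local_bound[OF v(1) this] show ?thesis
        using False unfolding B_def by auto
    qed
  qed (auto intro: gauge_trivial)
  also have "\<dots> \<le> M * (b - a) + e"
  proof -
    have "e' * (b - a) \<le> e' * (b - a + 1)"
      using \<open>e' > 0\<close> by (intro mult_left_mono) auto
    also have "\<dots> = e"
      using \<open>a \<le> b\<close> by (simp add: e'_def)
    finally show ?thesis
      by (simp add: algebra_simps)
  qed
  finally show "norm (g b - g a) \<le> M * (b - a) + e" .
qed

text \<open>Distinct intervals of a division overlap in negligible sets only, so their lengths add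
  up to the measure of their union, which lies in \<open>U\<close>.\<close>

lemma tagged_sum_content_le_measure:
  fixes a b :: real
  assumes p: "p tagged_division_of {a..b}" and "q \<subseteq> p"
    and U: "U \<in> lmeasurable" "\<And>s K. (s, K) \<in> q \<Longrightarrow> K \<subseteq> U"
  shows "(\<Sum>(s, K)\<in>q. measure lborel K) \<le> measure lebesgue U"
proof -
  have fin: "finite q"
    using p \<open>q \<subseteq> p\<close> by (meson finite_subset tagged_division_of_finite)
  have K: "\<exists>u v. snd x = cbox u v" if "x \<in> q" for x
    using tagged_division_ofD(4)[OF p] that \<open>q \<subseteq> p\<close> by (metis prod.collapse subsetD)
  have disj: "pairwise (\<lambda>x y. negligible (snd x \<inter> snd y)) q"
  proof (rule pairwiseI)
    fix x y
    assume xy: "x \<in> q" "y \<in> q" "x \<noteq> y"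
    then have "interior (snd x) \<inter> interior (snd y) = {}"
      using tagged_division_ofD(5)[OF p, of "fst x" "snd x" "fst y" "snd y"] \<open>q \<subseteq> p\<close> by auto
    moreover have "convex (snd x \<inter> snd y)"
      using K[OF xy(1)] K[OF xy(2)] by (auto intro: convex_Int convex_box)
    ultimately show "negligible (snd x \<inter> snd y)"
      using negligible_convex_interior by (metis interior_Int)
  qed
  have meas: "snd x \<in> lmeasurable" if "x \<in> q" for x
    using K[OF that] by auto
  have "(\<Sum>(s, K)\<in>q. measure lborel K) = (\<Sum>x\<in>q. measure lebesgue (snd x))"
    using K by (intro sum.cong refl) (fastforce simp: case_prod_unfold)
  also have "\<dots> = measure lebesgue (\<Union>(snd ` q))"
    using measure_negligible_finite_Union_image[OF fin meas disj] by simp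
  also have "\<dots> \<le> measure lebesgue U"
  proof (rule measure_mono_fmeasurable)
    show "\<Union>(snd ` q) \<subseteq> U"
      using U(2) by (metis SUP_least prod.collapse)
    show "\<Union>(snd ` q) \<in> sets lebesgue"
      using fin meas by (intro sets.finite_UN) (auto intro: fmeasurableD)
  qed (rule U(1))
  finally show ?thesis .
qed

lemma negligible_outer_open:
  fixes N :: "'a::euclidean_space set"
  assumes "negligible N" "d > 0"
  obtains U where "open U" "N \<subseteq> U" "U \<in> lmeasurable" "measure lebesgue U < d"
proof -
  have N: "N \<in> lmeasurable" "N \<in> null_sets lebesgue"
    using \<open>negligible N\<close> negligible_iff_measure negligible_iff_null_sets by blast+
  then obtain U where U: "open U" "N \<subseteq> U" "U - N \<in> lmeasurable" "emeasure lebesgue (U - N) < ennreal d"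
    using sets_lebesgue_outer_open[OF fmeasurableD \<open>d > 0\<close>] by metis
  have "U = (U - N) \<union> N"
    using U by blast
  then have "U \<in> lmeasurable"
    using U(3) N(1) by (metis fmeasurable.Un)
  moreover have "measure lebesgue U = measure lebesgue (U - N)"
    using N(2) U(1) by (simp add: measure_Diff_null_set)
  moreover have "measure lebesgue (U - N) < d"
    using U(4) \<open>d > 0\<close> emeasure_eq_measure2[OF U(3)] by (simp add: ennreal_less_iff)
  ultimately show thesis
    using that U by simp
qed

text \<open>Here the points of \<open>N\<close> are the exceptional tags. An open set of small
  measure containing \<open>N\<close> serves as the gauge on \<open>N\<close>; the intervals tagged
  there then have small total length, and absolute continuity makes the sum of their increments
  small.\<close>

lemma abs_continuous_mean_value_bound:
  fixes g :: "real \<Rightarrow> 'b::real_normed_vector"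
  assumes "a \<le> b" "negligible N" and ac: "abs_continuous_on a b g" and "0 \<le> M"
    and der: "\<And>s. s \<in> {a..b} - N \<Longrightarrow> \<exists>v. (g has_vector_derivative v) (at s) \<and> norm v \<le> M"
  shows "norm (g b - g a) \<le> M * (b - a)"
proof -
  \<comment> \<open>The local bound at points of differentiability needs a constant strictly above
    \<open>M\<close>; the limit \<open>M' \<rightarrow> M\<close> is taken at the end.\<close>
  have *: "norm (g b - g a) \<le> M' * (b - a)" if "M < M'" for M'
  proof (rule has_integral_local_bound_with_exceptions[OF \<open>a \<le> b\<close>, where N = N and B = "\<lambda>_. M'"])
    show "((\<lambda>_. M') has_integral M' * (b - a)) {a..b}"
      using has_integral_const_real[of M' a b] \<open>a \<le> b\<close> by (simp add: mult.commute)
    show "\<exists>d>0. \<forall>u\<in>{a..b}. \<bar>u - s\<bar> < d \<longrightarrow> norm (g u - g s) \<le> M' * \<bar>u - s\<bar>"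
      if "s \<in> {a..b} - N" for s
      using der[OF that] has_vector_derivative_local_bound[of g _ s M'] \<open>M < M'\<close> by fastforce
    show "0 \<le> M'" if "s \<in> N" for s
      using \<open>0 \<le> M\<close> \<open>M < M'\<close> by simp
    fix e :: real
    assume "e > 0"
    then obtain d where d: "d > 0" "\<And>n (x :: nat \<Rightarrow> real) y.
        (\<forall>i<n. a \<le> x i \<and> x i \<le> y i \<and> y i \<le> b) \<and>
        disjoint_family_on (\<lambda>i. {x i<..<y i}) {..<n} \<and> (\<Sum>i<n. y i - x i) < d
        \<Longrightarrow> (\<Sum>i<n. dist (g (x i)) (g (y i))) < e"
      using ac unfolding abs_continuous_on_def by meson
    obtain U where U: "open U" "N \<subseteq> U" "U \<in> lmeasurable" "measure lebesgue U < d"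
      using negligible_outer_open[OF \<open>negligible N\<close> d(1)] .
    define D where "D s = (if s \<in> N then U else UNIV)" for s
    have "gauge D"
      using U by (auto simp: gauge_def D_def)
    moreover have "(\<Sum>(s, K)\<in>{(s, K) \<in> p. s \<in> N}. norm (g (Sup K) - g (Inf K))) \<le> e"
      if p: "p tagged_division_of {a..b}" and fine: "D fine p" for p
    proof -
      define q where "q = {(s, K) \<in> p. s \<in> N}"
      have "q \<subseteq> p"
        by (auto simp: q_def)
      then have fin: "finite q"
        using p by (meson finite_subset tagged_division_of_finite)
      have len: "(\<Sum>(s, K)\<in>q. measure lborel K) < d"
      proof -
        have "K \<subseteq> U" if "(s, K) \<in> q" for s K
          using that fineD[OF fine, of s K] by (simp add: q_def D_def)
        then show ?thesis
          using order.strict_trans1[OF tagged_sum_content_le_measure[OF p \<open>q \<subseteq> p\<close> U(3)] U(4)] by blast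
      qed
      \<comment> \<open>Absolute continuity is formulated for families indexed by the numbers below
        \<open>n\<close>, so the intervals tagged in \<open>N\<close> are enumerated.\<close>
      obtain h where h: "bij_betw h {..<card q} q"
        using ex_bij_betw_nat_finite[OF fin] by (auto simp: lessThan_atLeast0)
      define x where "x i = Inf (snd (h i))" for i
      define y where "y i = Sup (snd (h i))" for i
      have hq: "h i \<in> p" if "i < card q" for i
        using h that \<open>q \<subseteq> p\<close> by (auto simp: bij_betw_def)
      have K: "snd (h i) = {x i..y i} \<and> a \<le> x i \<and> x i \<le> y i \<and> y i \<le> b \<and>
          measure lborel (snd (h i)) = y i - x i" if "i < card q" for i
      proof -
        have "(fst (h i), snd (h i)) \<in> p"
          using hq[OF that] by simp
        then obtain u v where "snd (h i) = {u..v}" "u \<le> fst (h i)" "fst (h i) \<le> v" "a \<le> u" "v \<le> b"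
          "Inf (snd (h i)) = u" "Sup (snd (h i)) = v" "measure lborel (snd (h i)) = v - u"
          by (rule tagged_division_of_realE[OF p])
        then show ?thesis
          unfolding x_def y_def by simp
      qed
      have "disjoint_family_on (\<lambda>i. {x i<..<y i}) {..<card q}"
        unfolding disjoint_family_on_def
      proof (intro ballI impI)
        fix i j
        assume ij: "i \<in> {..<card q}" "j \<in> {..<card q}" "i \<noteq> j"
        then have "h i \<noteq> h j"
          using h by (auto simp: bij_betw_def inj_on_def)
        then have "interior (snd (h i)) \<inter> interior (snd (h j)) = {}"
          using tagged_division_ofD(5)[OF p, of "fst (h i)" "snd (h i)" "fst (h j)" "snd (h j)"]
            hq ij by auto
        then show "{x i<..<y i} \<inter> {x j<..<y j} = {}"
          using K ij by (auto simp: interior_atLeastAtMost_real)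
      qed
      moreover have "(\<Sum>i<card q. y i - x i) < d"
      proof -
        have "(\<Sum>i<card q. y i - x i) = (\<Sum>i<card q. measure lborel (snd (h i)))"
          using K by simp
        also have "\<dots> = (\<Sum>r\<in>q. measure lborel (snd r))"
          by (rule sum.reindex_bij_betw[OF h])
        finally show ?thesis
          using len by (simp add: case_prod_unfold)
      qed
      ultimately have "(\<Sum>i<card q. dist (g (x i)) (g (y i))) < e"
        using K by (intro d(2)) auto
      also have "(\<Sum>i<card q. dist (g (x i)) (g (y i))) =
          (\<Sum>r\<in>q. norm (g (Sup (snd r)) - g (Inf (snd r))))"
        unfolding x_def y_def dist_norm
        by (subst sum.reindex_bij_betw[OF h, symmetric]) (simp add: norm_minus_commute)
      finally show ?thesis
        by (simp add: q_def case_prod_unfold)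
    qed
    ultimately show "\<exists>D. gauge D \<and> (\<forall>p. p tagged_division_of {a..b} \<and> D fine p \<longrightarrow>
      (\<Sum>(s, K)\<in>{(s, K) \<in> p. s \<in> N}. norm (g (Sup K) - g (Inf K))) \<le> e)"
      by (intro exI[of _ D] conjI allI impI) simp_all
  qed
  show ?thesis
  proof (rule field_le_epsilon)
    fix e :: real
    assume "e > 0"
    have "norm (g b - g a) \<le> (M + e / (b - a + 1)) * (b - a)"
      using \<open>e > 0\<close> \<open>a \<le> b\<close> by (intro *) auto
    also have "\<dots> = M * (b - a) + e / (b - a + 1) * (b - a)"
      by (rule distrib_right)
    also have "\<dots> \<le> M * (b - a) + e / (b - a + 1) * (b - a + 1)"
      using \<open>e > 0\<close> \<open>a \<le> b\<close> by (intro add_left_mono mult_left_mono) auto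
    finally show "norm (g b - g a) \<le> M * (b - a) + e"
      using \<open>a \<le> b\<close> by simp
  qed
qed

section \<open>Permanence properties of absolute continuity\<close>

lemma abs_continuous_on_subinterval:
  assumes "abs_continuous_on a b g" "a \<le> c" "d \<le> b"
  shows "abs_continuous_on c d g"
  unfolding abs_continuous_on_def
proof (intro allI impI)
  fix e :: real
  assume "e > 0"
  then obtain \<delta> where \<delta>: "\<delta> > 0" "\<forall>n (x :: nat \<Rightarrow> real) y. (\<forall>i<n. a \<le> x i \<and> x i \<le> y i \<and> y i \<le> b) \<and>
        disjoint_family_on (\<lambda>i. {x i<..<y i}) {..<n} \<and> (\<Sum>i<n. y i - x i) < \<delta>
        \<longrightarrow> (\<Sum>i<n. dist (g (x i)) (g (y i))) < e"
    using assms(1) unfolding abs_continuous_on_def by blast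
  show "\<exists>\<delta>>0. \<forall>n (x :: nat \<Rightarrow> real) y. (\<forall>i<n. c \<le> x i \<and> x i \<le> y i \<and> y i \<le> d) \<and>
        disjoint_family_on (\<lambda>i. {x i<..<y i}) {..<n} \<and> (\<Sum>i<n. y i - x i) < \<delta>
        \<longrightarrow> (\<Sum>i<n. dist (g (x i)) (g (y i))) < e"
  proof (intro exI[of _ \<delta>] conjI \<delta>(1) allI impI)
    fix n and x y :: "nat \<Rightarrow> real"
    assume "(\<forall>i<n. c \<le> x i \<and> x i \<le> y i \<and> y i \<le> d) \<and>
        disjoint_family_on (\<lambda>i. {x i<..<y i}) {..<n} \<and> (\<Sum>i<n. y i - x i) < \<delta>"
    moreover from this have "\<forall>i<n. a \<le> x i \<and> x i \<le> y i \<and> y i \<le> b"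
      using assms(2,3) by (meson order_trans)
    ultimately show "(\<Sum>i<n. dist (g (x i)) (g (y i))) < e"
      using \<delta>(2) by blast
  qed
qed

lemma abs_continuous_on_dist_le:
  assumes "abs_continuous_on a b g" and le: "\<And>u v. dist (h u) (h v) \<le> dist (g u) (g v)"
  shows "abs_continuous_on a b h"
proof -
  have "(\<Sum>i<n. dist (h (x i)) (h (y i))) < e" if "(\<Sum>i<n. dist (g (x i)) (g (y i))) < e"
    for e n and x y :: "nat \<Rightarrow> real"
    using sum_mono[of "{..<n}" "\<lambda>i. dist (h (x i)) (h (y i))" "\<lambda>i. dist (g (x i)) (g (y i))"]
      le that by fastforce
  then show ?thesis
    using assms(1) unfolding abs_continuous_on_def by meson
qed

lemma lipschitz_on_imp_abs_continuous_on:
  assumes "L-lipschitz_on {a..b} g"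
  shows "abs_continuous_on a b g"
  unfolding abs_continuous_on_def
proof (intro allI impI)
  fix e :: real
  assume "e > 0"
  have L: "L \<ge> 0"
    using assms by (rule lipschitz_on_nonneg)
  show "\<exists>d>0. \<forall>n (x :: nat \<Rightarrow> real) y. (\<forall>i<n. a \<le> x i \<and> x i \<le> y i \<and> y i \<le> b) \<and>
        disjoint_family_on (\<lambda>i. {x i<..<y i}) {..<n} \<and> (\<Sum>i<n. y i - x i) < d
        \<longrightarrow> (\<Sum>i<n. dist (g (x i)) (g (y i))) < e"
  \<comment> \<open>Using \<open>L + 1\<close> in place of \<open>L\<close> avoids a division by
    zero for constant curves.\<close>
  proof (intro exI[of _ "e / (L + 1)"] conjI allI impI)
    fix n and x y :: "nat \<Rightarrow> real"
    assume A: "(\<forall>i<n. a \<le> x i \<and> x i \<le> y i \<and> y i \<le> b) \<and>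
        disjoint_family_on (\<lambda>i. {x i<..<y i}) {..<n} \<and> (\<Sum>i<n. y i - x i) < e / (L + 1)"
    have "(\<Sum>i<n. dist (g (x i)) (g (y i))) \<le> (\<Sum>i<n. (L + 1) * (y i - x i))"
    proof (rule sum_mono)
      fix i
      assume "i \<in> {..<n}"
      then have i: "a \<le> x i" "x i \<le> y i" "y i \<le> b"
        using A by auto
      then have "dist (g (x i)) (g (y i)) \<le> L * dist (x i) (y i)"
        by (intro lipschitz_onD[OF assms]) auto
      then show "dist (g (x i)) (g (y i)) \<le> (L + 1) * (y i - x i)"
        using i by (simp add: dist_real_def algebra_simps)
    qed
    also have "\<dots> = (L + 1) * (\<Sum>i<n. y i - x i)"
      by (simp add: sum_distrib_left)
    also have "\<dots> < e"
      using A L pos_less_divide_eq[of "L + 1" "\<Sum>i<n. y i - x i" e] by (simp add: mult.commute)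
    finally show "(\<Sum>i<n. dist (g (x i)) (g (y i))) < e" .
  qed (use \<open>e > 0\<close> L in auto)
qed

section \<open>Horizontal curves\<close>

text \<open>Explicit coefficients replace the definite description in \<open>cc_norm\<close>, so
  that the chain rule can use them directly.\<close>

definition unit_horizontal :: "nat \<Rightarrow> real ^ 3 \<Rightarrow> real ^ 3 \<Rightarrow> bool" where
  "unit_horizontal k p v \<longleftrightarrow> (\<exists>c1 c2. v = c1 *\<^sub>R X1 k p + c2 *\<^sub>R X2 k p \<and> c1\<^sup>2 + c2\<^sup>2 \<le> 1)"

text \<open>These are the competitors in the infimum \<open>cc_dist\<close>. The endpoints are left
  free so that initial segments and concatenations are curves of the same kind.\<close>

definition cc_curve :: "nat \<Rightarrow> real \<Rightarrow> (real \<Rightarrow> real ^ 3) \<Rightarrow> bool" where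
  "cc_curve k \<tau> \<gamma> \<longleftrightarrow> 0 \<le> \<tau> \<and> horizontal_curve k \<tau> \<gamma> \<and>
     (AE s in lebesgue. s \<in> {0..\<tau>} \<longrightarrow> cc_norm k (\<gamma> s) (vector_derivative \<gamma> (at s)) \<le> 1)"

lemma cc_dist_eq_Inf_cc_curve:
  "cc_dist k x y = Inf {\<tau>. \<exists>\<gamma>. cc_curve k \<tau> \<gamma> \<and> \<gamma> 0 = x \<and> \<gamma> \<tau> = y}"
  unfolding cc_dist_def cc_curve_def by (rule arg_cong[where f = Inf]) auto

lemma X_component [simp]:
  "X1 k p $ 1 = 1" "X1 k p $ 2 = 0" "X1 k p $ 3 = p $ 2 * ((p $ 1)\<^sup>2 + (p $ 2)\<^sup>2) ^ (k - 1)"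
  "X2 k p $ 1 = 0" "X2 k p $ 2 = 1" "X2 k p $ 3 = - (p $ 1) * ((p $ 1)\<^sup>2 + (p $ 2)\<^sup>2) ^ (k - 1)"
  by (simp_all add: X1_def X2_def)

lemma mem_span_X1_X2:
  "v \<in> span {X1 k p, X2 k p} \<longleftrightarrow> (\<exists>c1 c2. v = c1 *\<^sub>R X1 k p + c2 *\<^sub>R X2 k p)"
  by (auto simp: span_insert span_singleton algebra_simps)

text \<open>The first two coordinates of a horizontal vector are its coefficients, so the
  coefficients are unique and the definite description in \<open>cc_norm\<close> denotes.\<close>

lemma cc_norm_combination:
  "cc_norm k p (c1 *\<^sub>R X1 k p + c2 *\<^sub>R X2 k p) = sqrt (c1\<^sup>2 + c2\<^sup>2)"
  unfolding cc_norm_def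
proof (rule the_equality)
  fix r
  assume "\<exists>d1 d2. c1 *\<^sub>R X1 k p + c2 *\<^sub>R X2 k p = d1 *\<^sub>R X1 k p + d2 *\<^sub>R X2 k p \<and>
      r = sqrt (d1\<^sup>2 + d2\<^sup>2)"
  then obtain d1 d2 where
    d: "c1 *\<^sub>R X1 k p + c2 *\<^sub>R X2 k p = d1 *\<^sub>R X1 k p + d2 *\<^sub>R X2 k p" "r = sqrt (d1\<^sup>2 + d2\<^sup>2)"
    by blast
  have "c1 = d1" "c2 = d2"
    using arg_cong[OF d(1), of "\<lambda>v. v $ 1"] arg_cong[OF d(1), of "\<lambda>v. v $ 2"] by auto
  then show "r = sqrt (c1\<^sup>2 + c2\<^sup>2)"
    using d(2) by simp
qed blast

lemma AE_lebesgue_imp_negligible: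
  assumes "AE s in lebesgue. P s"
  obtains N where "negligible N" "\<And>s. s \<notin> N \<Longrightarrow> P s"
  using assms by (auto simp: eventually_ae_filter negligible_iff_null_sets)

text \<open>This merges the two almost-everywhere conditions into one negligible set, the form that
  the mean value inequalities take. \<open>cc_curveI\<close> goes back, for Lipschitz
  curves.\<close>

lemma cc_curveE:
  assumes "cc_curve k \<tau> \<gamma>"
  obtains N where "negligible N"
    "\<And>s. s \<in> {0..\<tau>} - N \<Longrightarrow> \<exists>v. (\<gamma> has_vector_derivative v) (at s) \<and> unit_horizontal k (\<gamma> s) v"
proof -
  have "AE s in lebesgue. s \<in> {0..\<tau>} \<longrightarrow>
        (\<exists>v. (\<gamma> has_vector_derivative v) (at s) \<and> v \<in> span {X1 k (\<gamma> s), X2 k (\<gamma> s)})"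
    and "AE s in lebesgue. s \<in> {0..\<tau>} \<longrightarrow> cc_norm k (\<gamma> s) (vector_derivative \<gamma> (at s)) \<le> 1"
    using assms unfolding cc_curve_def horizontal_curve_def by blast+
  then have "AE s in lebesgue. s \<in> {0..\<tau>} \<longrightarrow>
        (\<exists>v. (\<gamma> has_vector_derivative v) (at s) \<and> unit_horizontal k (\<gamma> s) v)"
  proof eventually_elim
    case (elim s)
    show ?case
    proof
      assume "s \<in> {0..\<tau>}"
      with elim(1) obtain v where v: "(\<gamma> has_vector_derivative v) (at s)" "v \<in> span {X1 k (\<gamma> s), X2 k (\<gamma> s)}"
        by blast
      then obtain c1 c2 where c: "v = c1 *\<^sub>R X1 k (\<gamma> s) + c2 *\<^sub>R X2 k (\<gamma> s)"
        unfolding mem_span_X1_X2 by blast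
      have "sqrt (c1\<^sup>2 + c2\<^sup>2) \<le> 1"
        using elim(2) \<open>s \<in> {0..\<tau>}\<close> vector_derivative_at[OF v(1)] c by (simp add: cc_norm_combination)
      then show "\<exists>v. (\<gamma> has_vector_derivative v) (at s) \<and> unit_horizontal k (\<gamma> s) v"
        using v(1) c unfolding unit_horizontal_def by auto
    qed
  qed
  then show thesis
    using that by (elim AE_lebesgue_imp_negligible) blast
qed

lemma cc_curveI:
  assumes "0 \<le> \<tau>" "L-lipschitz_on {0..\<tau>} \<gamma>" "negligible N"
    and der: "\<And>s. s \<in> {0..\<tau>} - N \<Longrightarrow>
      \<exists>v. (\<gamma> has_vector_derivative v) (at s) \<and> unit_horizontal k (\<gamma> s) v"
  shows "cc_curve k \<tau> \<gamma>"
proof -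
  have N: "AE s in lebesgue. s \<notin> N"
    using \<open>negligible N\<close> by (simp add: negligible_iff_null_sets AE_not_in)
  have "horizontal_curve k \<tau> \<gamma>"
    unfolding horizontal_curve_def
  proof (intro conjI)
    show "AE s in lebesgue. s \<in> {0..\<tau>} \<longrightarrow>
        (\<exists>v. (\<gamma> has_vector_derivative v) (at s) \<and> v \<in> span {X1 k (\<gamma> s), X2 k (\<gamma> s)})"
      using N by eventually_elim (use der in \<open>auto simp: mem_span_X1_X2 unit_horizontal_def, blast\<close>)
  qed (rule lipschitz_on_imp_abs_continuous_on[OF assms(2)])
  moreover have "AE s in lebesgue. s \<in> {0..\<tau>} \<longrightarrow> cc_norm k (\<gamma> s) (vector_derivative \<gamma> (at s)) \<le> 1"
    using N
  proof eventually_elim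
    case (elim s)
    show ?case
    proof
      assume "s \<in> {0..\<tau>}"
      then obtain v where v: "(\<gamma> has_vector_derivative v) (at s)" "unit_horizontal k (\<gamma> s) v"
        using der elim by blast
      then show "cc_norm k (\<gamma> s) (vector_derivative \<gamma> (at s)) \<le> 1"
        using vector_derivative_at[OF v(1)] by (auto simp: unit_horizontal_def cc_norm_combination)
    qed
  qed
  ultimately show ?thesis
    using \<open>0 \<le> \<tau>\<close> by (simp add: cc_curve_def)
qed

text \<open>Together with \<open>cc_dist_le\<close> this shows that \<open>\<gamma> s\<close> has
  distance at most \<open>s\<close> from the starting point.\<close>

lemma cc_curve_initial_segment:
  assumes "cc_curve k \<tau> \<gamma>" "0 \<le> s" "s \<le> \<tau>"
  shows "cc_curve k s \<gamma>"
proof -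
  have sub: "AE u in lebesgue. u \<in> {0..s} \<longrightarrow> P u" if "AE u in lebesgue. u \<in> {0..\<tau>} \<longrightarrow> P u" for P
    using that by eventually_elim (use \<open>s \<le> \<tau>\<close> in auto)
  have "abs_continuous_on 0 s \<gamma>" if "abs_continuous_on 0 \<tau> \<gamma>"
    using that \<open>s \<le> \<tau>\<close> by (rule abs_continuous_on_subinterval[OF _ order_refl])
  then show ?thesis
    using assms(1,2) unfolding cc_curve_def horizontal_curve_def by (simp only: sub simp_thms)
qed

lemma cc_dist_le:
  assumes "cc_curve k \<tau> \<gamma>"
  shows "cc_dist k (\<gamma> 0) (\<gamma> \<tau>) \<le> \<tau>"
  unfolding cc_dist_eq_Inf_cc_curve using assms
  by (intro cInf_lower bdd_belowI[of _ 0]) (auto simp: cc_curve_def)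

section \<open>Euclidean bounds for horizontal curves\<close>

definition cc_speed_bound :: "nat \<Rightarrow> real \<Rightarrow> real" where
  "cc_speed_bound k R = 2 + 2 * R * (2 * R\<^sup>2) ^ (k - 1)"

lemma unit_horizontal_component_le:
  assumes "unit_horizontal k p v"
  shows "\<bar>v $ 1\<bar> \<le> 1" "\<bar>v $ 2\<bar> \<le> 1"
proof -
  obtain c1 c2 where c: "v = c1 *\<^sub>R X1 k p + c2 *\<^sub>R X2 k p" "c1\<^sup>2 + c2\<^sup>2 \<le> 1"
    using assms unfolding unit_horizontal_def by blast
  have "c1\<^sup>2 \<le> 1" "c2\<^sup>2 \<le> 1"
    using c(2) zero_le_power2[of c1] zero_le_power2[of c2] by linarith+
  then show "\<bar>v $ 1\<bar> \<le> 1" "\<bar>v $ 2\<bar> \<le> 1"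
    using c(1) by (auto simp: abs_square_le_1)
qed

text \<open>The sum of the absolute values of the coordinates dominates the norm. The two planar
  coordinates contribute at most 2, and the third is a factor of size at most \<open>2 * R\<close>
  times a power of a number at most \<open>2 * R\<^sup>2\<close>.\<close>

lemma unit_horizontal_norm_le:
  assumes v: "unit_horizontal k p v" and p: "\<bar>p $ 1\<bar> \<le> R" "\<bar>p $ 2\<bar> \<le> R"
  shows "norm v \<le> cc_speed_bound k R"
proof -
  have "R \<ge> 0"
    using p by linarith
  define A where "A = ((p $ 1)\<^sup>2 + (p $ 2)\<^sup>2) ^ (k - 1)"
  \<comment> \<open>As \<open>v $ 1\<close> and \<open>v $ 2\<close> are the coefficients of
    \<open>v\<close>, horizontality determines \<open>v $ 3\<close> from them.\<close>
  have "v $ 3 = (v $ 1 * p $ 2 - v $ 2 * p $ 1) * A"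
    using v by (auto simp: unit_horizontal_def A_def algebra_simps)
  have "(p $ 1)\<^sup>2 \<le> R\<^sup>2" "(p $ 2)\<^sup>2 \<le> R\<^sup>2"
    using p by (simp_all add: abs_le_square_iff[symmetric])
  then have "(p $ 1)\<^sup>2 + (p $ 2)\<^sup>2 \<le> 2 * R\<^sup>2"
    by linarith
  then have A: "0 \<le> A" "A \<le> (2 * R\<^sup>2) ^ (k - 1)"
    unfolding A_def by (simp, rule power_mono) simp_all
  have "\<bar>v $ 1 * p $ 2\<bar> \<le> 1 * R" "\<bar>v $ 2 * p $ 1\<bar> \<le> 1 * R"
    unfolding abs_mult using unit_horizontal_component_le[OF v] p by (intro mult_mono; simp)+
  then have "\<bar>v $ 1 * p $ 2 - v $ 2 * p $ 1\<bar> \<le> 2 * R"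
    by linarith
  then have "\<bar>v $ 3\<bar> \<le> 2 * R * (2 * R\<^sup>2) ^ (k - 1)"
    unfolding \<open>v $ 3 = _\<close> abs_mult using A \<open>R \<ge> 0\<close> by (intro mult_mono) auto
  moreover have "norm v \<le> \<bar>v $ 1\<bar> + \<bar>v $ 2\<bar> + \<bar>v $ 3\<bar>"
    using norm_le_l1_cart[of v] by (simp add: sum_3)
  ultimately show ?thesis
    using unit_horizontal_component_le[OF v] by (simp add: cc_speed_bound_def)
qed

lemma cc_speed_bound_nonneg: "R \<ge> 0 \<Longrightarrow> cc_speed_bound k R \<ge> 0"
  by (simp add: cc_speed_bound_def)

lemma cc_speed_bound_mono: "0 \<le> R \<Longrightarrow> R \<le> S \<Longrightarrow> cc_speed_bound k R \<le> cc_speed_bound k S"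
  unfolding cc_speed_bound_def by (intro add_left_mono mult_mono power_mono) auto

text \<open>The planar coordinates move at speed at most 1 wherever the curve is, so they can be
  bounded before anything is known about the third one, whose speed depends on them.\<close>

lemma cc_curve_planar_bound:
  assumes "cc_curve k \<tau> \<gamma>" "s \<in> {0..\<tau>}" "i = 1 \<or> i = 2"
  shows "\<bar>\<gamma> s $ i - \<gamma> 0 $ i\<bar> \<le> s"
proof -
  obtain N where N: "negligible N"
    "\<And>s. s \<in> {0..\<tau>} - N \<Longrightarrow> \<exists>v. (\<gamma> has_vector_derivative v) (at s) \<and> unit_horizontal k (\<gamma> s) v"
    by (rule cc_curveE[OF assms(1)]) blast
  have ac: "abs_continuous_on 0 s \<gamma>"
    using assms(1,2) unfolding cc_curve_def horizontal_curve_def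
    by (auto elim!: abs_continuous_on_subinterval)
  have "norm (\<gamma> s $ i - \<gamma> 0 $ i) \<le> 1 * (s - 0)"
  proof (rule abs_continuous_mean_value_bound[where N = N and g = "\<lambda>s. \<gamma> s $ i"])
    show "abs_continuous_on 0 s (\<lambda>s. \<gamma> s $ i)"
      using ac by (rule abs_continuous_on_dist_le) (rule dist_vec_nth_le)
    fix u
    assume "u \<in> {0..s} - N"
    then obtain v where v: "(\<gamma> has_vector_derivative v) (at u)" "unit_horizontal k (\<gamma> u) v"
      using N(2)[of u] assms(2) by auto
    have "((\<lambda>s. \<gamma> s $ i) has_vector_derivative v $ i) (at u)"
      using bounded_linear.has_vector_derivative[OF bounded_linear_vec_nth v(1)] .
    then show "\<exists>v. ((\<lambda>s. \<gamma> s $ i) has_vector_derivative v) (at u) \<and> norm v \<le> 1"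
      using unit_horizontal_component_le[OF v(2)] assms(3) by auto
  qed (use assms(2) N(1) in auto)
  then show ?thesis
    by simp
qed

text \<open>The planar bound confines the first two coordinates for the whole duration, and there
  the Euclidean speed is bounded. Absolute continuity turns this almost-everywhere bound into a
  Lipschitz constant.\<close>

lemma cc_curve_lipschitz:
  assumes "cc_curve k \<tau> \<gamma>"
  shows "(cc_speed_bound k (norm (\<gamma> 0) + \<tau>))-lipschitz_on {0..\<tau>} \<gamma>" (is "?L-lipschitz_on _ _")
proof (rule lipschitz_on_leI)
  obtain N where N: "negligible N"
    "\<And>s. s \<in> {0..\<tau>} - N \<Longrightarrow> \<exists>v. (\<gamma> has_vector_derivative v) (at s) \<and> unit_horizontal k (\<gamma> s) v"
    by (rule cc_curveE[OF assms]) blast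
  show L: "?L \<ge> 0"
    using assms by (intro cc_speed_bound_nonneg) (auto simp: cc_curve_def)
  fix a b
  assume ab: "a \<in> {0..\<tau>}" "b \<in> {0..\<tau>}" "a \<le> b"
  have "norm (\<gamma> b - \<gamma> a) \<le> ?L * (b - a)"
  proof (rule abs_continuous_mean_value_bound[OF ab(3) N(1) _ L])
    show "abs_continuous_on a b \<gamma>"
      using assms ab unfolding cc_curve_def horizontal_curve_def
      by (auto elim!: abs_continuous_on_subinterval)
    fix s
    assume s: "s \<in> {a..b} - N"
    then have s': "s \<in> {0..\<tau>}"
      using ab by auto
    obtain v where v: "(\<gamma> has_vector_derivative v) (at s)" "unit_horizontal k (\<gamma> s) v"
      using N(2)[of s] s s' by auto
    have "\<bar>\<gamma> s $ i\<bar> \<le> norm (\<gamma> 0) + \<tau>" if "i = 1 \<or> i = 2" for i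
      using cc_curve_planar_bound[OF assms s' that] component_le_norm_cart[of "\<gamma> 0" i] s' by auto
    then have "norm v \<le> ?L"
      by (intro unit_horizontal_norm_le[OF v(2)]) auto
    then show "\<exists>v. (\<gamma> has_vector_derivative v) (at s) \<and> norm v \<le> ?L"
      using v(1) by blast
  qed
  then show "dist (\<gamma> a) (\<gamma> b) \<le> ?L * dist a b"
    using ab by (simp add: dist_norm norm_minus_commute)
qed

section \<open>Connectivity by horizontal curves\<close>

definition cc_connected :: "nat \<Rightarrow> real ^ 3 \<Rightarrow> real ^ 3 \<Rightarrow> bool" where
  "cc_connected k x y \<longleftrightarrow> (\<exists>\<tau> \<gamma>. cc_curve k \<tau> \<gamma> \<and> \<gamma> 0 = x \<and> \<gamma> \<tau> = y)"

lemma cc_connected_trans [trans]: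
  assumes "cc_connected k x y" "cc_connected k y z"
  shows "cc_connected k x z"
proof -
  obtain a \<gamma> where \<gamma>: "cc_curve k a \<gamma>" "\<gamma> 0 = x" "\<gamma> a = y"
    using assms(1) unfolding cc_connected_def by blast
  obtain b \<beta> where \<beta>: "cc_curve k b \<beta>" "\<beta> 0 = y" "\<beta> b = z"
    using assms(2) unfolding cc_connected_def by blast
  have ab: "a \<ge> 0" "b \<ge> 0"
    using \<gamma> \<beta> by (auto simp: cc_curve_def)
  obtain N1 where N1: "negligible N1"
    "\<And>s. s \<in> {0..a} - N1 \<Longrightarrow> \<exists>v. (\<gamma> has_vector_derivative v) (at s) \<and> unit_horizontal k (\<gamma> s) v"
    by (rule cc_curveE[OF \<gamma>(1)]) blast
  obtain N2 where N2: "negligible N2"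
    "\<And>s. s \<in> {0..b} - N2 \<Longrightarrow> \<exists>v. (\<beta> has_vector_derivative v) (at s) \<and> unit_horizontal k (\<beta> s) v"
    by (rule cc_curveE[OF \<beta>(1)]) blast
  let ?\<beta> = "\<lambda>s. \<beta> (s - a)"
  let ?\<alpha> = "\<lambda>s. if s \<le> a then \<gamma> s else ?\<beta> s"
  obtain L1 L2 where L: "L1-lipschitz_on {0..a} \<gamma>" "L2-lipschitz_on {0..b} \<beta>"
    using cc_curve_lipschitz \<gamma>(1) \<beta>(1) by blast
  have "L2-lipschitz_on {a..a + b} ?\<beta>"
  proof (rule lipschitz_onI)
    fix s t
    assume "s \<in> {a..a + b}" "t \<in> {a..a + b}"
    then have "dist (\<beta> (s - a)) (\<beta> (t - a)) \<le> L2 * dist (s - a) (t - a)"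
      by (intro lipschitz_onD[OF L(2)]) auto
    then show "dist (\<beta> (s - a)) (\<beta> (t - a)) \<le> L2 * dist s t"
      by (simp add: dist_real_def)
  qed (rule lipschitz_on_nonneg[OF L(2)])
  then have lip: "(max L1 L2)-lipschitz_on {0..a + b} ?\<alpha>"
    using L(1) \<gamma>(3) \<beta>(2) by (intro lipschitz_on_concat_max) auto
  have "cc_curve k (a + b) ?\<alpha>"
  proof (rule cc_curveI[OF _ lip])
    \<comment> \<open>The junction time \<open>a\<close> joins the null set because the one-sided
      velocities may differ there; the null set of the second curve is shifted along with its
      parameter.\<close>
    show "negligible (insert a (N1 \<union> (+) a ` N2))"
      using N1(1) N2(1) by (auto intro: negligible_translation)
    fix s
    assume s: "s \<in> {0..a + b} - insert a (N1 \<union> (+) a ` N2)"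
    consider "s < a" | "s > a"
      using s by fastforce
    then show "\<exists>v. (?\<alpha> has_vector_derivative v) (at s) \<and> unit_horizontal k (?\<alpha> s) v"
    proof cases
      case 1
      then obtain v where v: "(\<gamma> has_vector_derivative v) (at s)" "unit_horizontal k (\<gamma> s) v"
        using N1(2)[of s] s by auto
      have "(?\<alpha> has_vector_derivative v) (at s)"
        by (rule has_vector_derivative_transform_within_open[OF v(1), of "{..<a}"]) (use 1 in auto)
      then show ?thesis
        using v(2) 1 by auto
    next
      case 2
      have "s - a \<notin> N2"
        using s by (auto simp: image_iff)
      then obtain v where v: "(\<beta> has_vector_derivative v) (at (s - a))" "unit_horizontal k (\<beta> (s - a)) v"
        using N2(2)[of "s - a"] s 2 by auto
      have "((\<lambda>s. s - a) has_vector_derivative 1) (at s)"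
        by (auto intro!: derivative_eq_intros simp: has_vector_derivative_def)
      then have "(?\<beta> has_vector_derivative v) (at s)"
        using vector_diff_chain_at[of "\<lambda>s. s - a" 1 s \<beta> v] v(1) by (simp add: o_def)
      then have "(?\<alpha> has_vector_derivative v) (at s)"
        by (rule has_vector_derivative_transform_within_open[of _ _ _ "{a<..}"]) (use 2 in auto)
      then show ?thesis
        using v(2) 2 by auto
    qed
  qed (use ab in auto)
  moreover have "?\<alpha> 0 = x" "?\<alpha> (a + b) = z"
    using ab \<gamma> \<beta> by auto
  ultimately show ?thesis
    unfolding cc_connected_def by blast
qed

lemma cc_connected_smooth:
  assumes "0 \<le> \<tau>"
    and der: "\<And>s. (\<gamma> has_vector_derivative v s) (at s)"
    and hor: "\<And>s. unit_horizontal k (\<gamma> s) (v s)"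
    and L: "\<And>s. norm (v s) \<le> L"
  shows "cc_connected k (\<gamma> 0) (\<gamma> \<tau>)"
proof -
  have "L-lipschitz_on {0..\<tau>} \<gamma>"
  proof (rule lipschitz_on_leI)
    fix a b :: real
    assume "a \<le> b"
    have "norm (\<gamma> b - \<gamma> a) \<le> L * norm (b - a)"
    proof (rule differentiable_bound[of UNIV \<gamma> "\<lambda>s h. h *\<^sub>R v s"])
      fix s :: real
      show "(\<gamma> has_derivative (\<lambda>h. h *\<^sub>R v s)) (at s within UNIV)"
        using der[of s] by (simp add: has_vector_derivative_def)
      show "onorm (\<lambda>h. h *\<^sub>R v s) \<le> L"
      proof (rule onorm_bound)
        show "0 \<le> L"
          using L[of s] norm_ge_zero order_trans by blast
        show "norm (h *\<^sub>R v s) \<le> L * norm h" for h :: real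
          using mult_left_mono[OF L[of s], of "\<bar>h\<bar>"] by (simp add: mult.commute)
      qed
    qed auto
    then show "dist (\<gamma> a) (\<gamma> b) \<le> L * dist a b"
      by (simp add: dist_norm norm_minus_commute abs_minus_commute)
  qed (use L norm_ge_zero order_trans in blast)
  then have "cc_curve k \<tau> \<gamma>"
    using der hor by (intro cc_curveI[where N = "{}"] \<open>0 \<le> \<tau>\<close>) auto
  then show ?thesis
    unfolding cc_connected_def by blast
qed

section \<open>Explicit horizontal curves: radial segments and arcs of the unit circle\<close>

lemma vector_3_expand:
  "(vector [a, b, c] :: real ^ 3) = a *\<^sub>R axis 1 1 + b *\<^sub>R axis 2 1 + c *\<^sub>R axis 3 1"
  by (simp add: vec_eq_iff forall_3 axis_def)

lemma has_vector_derivative_vector_3: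
  assumes "(f has_real_derivative f') (at s)" "(g has_real_derivative g') (at s)"
    "(h has_real_derivative h') (at s)"
  shows "((\<lambda>s. vector [f s, g s, h s] :: real ^ 3) has_vector_derivative vector [f', g', h']) (at s)"
  unfolding vector_3_expand
  by (intro has_vector_derivative_add)
     (use has_vector_derivative_scaleR[OF assms(1) has_vector_derivative_const]
        has_vector_derivative_scaleR[OF assms(2) has_vector_derivative_const]
        has_vector_derivative_scaleR[OF assms(3) has_vector_derivative_const] in simp_all)

text \<open>The planar position is parallel to the direction \<open>(e1, e2)\<close>, so the two
  contributions to the third velocity component cancel.\<close>

lemma cc_connected_radial:
  assumes "e1\<^sup>2 + e2\<^sup>2 \<le> 1" "a \<le> b"
  shows "cc_connected k (vector [a * e1, a * e2, t]) (vector [b * e1, b * e2, t])"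
proof -
  let ?\<gamma> = "\<lambda>s. vector [(a + s) * e1, (a + s) * e2, t] :: real ^ 3"
  have "cc_connected k (?\<gamma> 0) (?\<gamma> (b - a))"
  proof (rule cc_connected_smooth)
    fix s
    show "(?\<gamma> has_vector_derivative vector [e1, e2, 0]) (at s)"
      by (rule has_vector_derivative_vector_3) (auto intro!: derivative_eq_intros)
    have "(vector [e1, e2, 0] :: real ^ 3) = e1 *\<^sub>R X1 k (?\<gamma> s) + e2 *\<^sub>R X2 k (?\<gamma> s)"
      by (simp add: vec_eq_iff forall_3)
    then show "unit_horizontal k (?\<gamma> s) (vector [e1, e2, 0])"
      using assms(1) unfolding unit_horizontal_def by blast
  qed (use assms(2) in auto)
  then show ?thesis
    by simp
qed

text \<open>On the unit circle the factor with exponent \<open>k - 1\<close> equals 1 for every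
  \<open>k\<close>, and unit-speed rotation changes the third coordinate at the constant rate
  \<open>- \<epsilon>\<close>; the sign is chosen by the orientation.\<close>

lemma cc_connected_circle:
  assumes "\<epsilon> = 1 \<or> \<epsilon> = - 1" "\<theta> \<ge> 0"
  shows "cc_connected k (vector [1, 0, t]) (vector [cos \<theta>, \<epsilon> * sin \<theta>, t - \<epsilon> * \<theta>])"
proof -
  let ?\<gamma> = "\<lambda>s. vector [cos s, \<epsilon> * sin s, t - \<epsilon> * s] :: real ^ 3"
  let ?v = "\<lambda>s. vector [- sin s, \<epsilon> * cos s, - \<epsilon>] :: real ^ 3"
  have \<epsilon>: "\<epsilon>\<^sup>2 = 1" "\<epsilon> * \<epsilon> = 1"
    using assms(1) by auto
  have "cc_connected k (?\<gamma> 0) (?\<gamma> \<theta>)"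
  proof (rule cc_connected_smooth)
    fix s
    show "(?\<gamma> has_vector_derivative ?v s) (at s)"
      by (rule has_vector_derivative_vector_3) (auto intro!: derivative_eq_intros)
    have 1: "(cos s)\<^sup>2 + (\<epsilon> * sin s)\<^sup>2 = 1" "(- sin s)\<^sup>2 + (\<epsilon> * cos s)\<^sup>2 = 1"
      by (simp_all add: power_mult_distrib \<epsilon>)
    have "- \<epsilon> = - sin s * (\<epsilon> * sin s) + \<epsilon> * cos s * - cos s"
    proof -
      have "- sin s * (\<epsilon> * sin s) + \<epsilon> * cos s * - cos s = - \<epsilon> * ((sin s)\<^sup>2 + (cos s)\<^sup>2)"
        by algebra
      then show ?thesis
        by simp
    qed
    then have "?v s = (- sin s) *\<^sub>R X1 k (?\<gamma> s) + (\<epsilon> * cos s) *\<^sub>R X2 k (?\<gamma> s)"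
      using 1(1) by (simp add: vec_eq_iff forall_3)
    then show h: "unit_horizontal k (?\<gamma> s) (?v s)"
      using 1(2) unfolding unit_horizontal_def by fastforce
    have "\<bar>?\<gamma> s $ 1\<bar> \<le> 1" "\<bar>?\<gamma> s $ 2\<bar> \<le> 1"
      using assms(1) by auto
    then show "norm (?v s) \<le> cc_speed_bound k 1"
      by (rule unit_horizontal_norm_le[OF h])
  qed (use assms(2) in auto)
  then show ?thesis
    by simp
qed

lemma cc_connected_origin:
  fixes p :: "real ^ 3"
  shows "cc_connected k p (vector [0, 0, p $ 3])" "cc_connected k (vector [0, 0, p $ 3]) p"
proof -
  \<comment> \<open>This scales the direction to length at most 1; the summand 1 makes
    \<open>r\<close> positive even when \<open>p\<close> is the origin.\<close>
  define r where "r = norm p + 1"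
  have "r > 0"
    by (simp add: r_def add_nonneg_pos)
  have "(p $ 1)\<^sup>2 + (p $ 2)\<^sup>2 \<le> (norm p)\<^sup>2"
    unfolding power2_norm_eq_inner by (simp add: inner_vec_def sum_3 power2_eq_square)
  also have "\<dots> \<le> r\<^sup>2"
    by (simp add: r_def power_mono)
  finally have e: "(p $ 1 / r)\<^sup>2 + (p $ 2 / r)\<^sup>2 \<le> 1"
    using \<open>r > 0\<close> by (simp add: power_divide add_divide_distrib[symmetric] divide_le_eq)
  have p: "vector [r * (p $ 1 / r), r * (p $ 2 / r), p $ 3] = p"
    using \<open>r > 0\<close> by (simp add: vec_eq_iff forall_3)
  show "cc_connected k (vector [0, 0, p $ 3]) p"
    using cc_connected_radial[OF e, of 0 r k "p $ 3"] \<open>r > 0\<close> unfolding p by simp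
  \<comment> \<open>The inward segment is the radial one for the opposite direction, with its
    parameter running from \<open>- r\<close> up to 0.\<close>
  show "cc_connected k p (vector [0, 0, p $ 3])"
    using cc_connected_radial[of "- (p $ 1 / r)" "- (p $ 2 / r)" "- r" 0 k "p $ 3"] e \<open>r > 0\<close> p by simp
qed

text \<open>Radial segments keep \<open>t\<close> constant, while \<open>t\<close> changes at unit rate along the unit circle, which
  may be traversed several times and in either direction.\<close>

theorem cc_connected: "cc_connected k x y"
proof -
  define \<epsilon> :: real where "\<epsilon> = (if x $ 3 \<ge> y $ 3 then 1 else - 1)"
  define \<theta> where "\<theta> = \<bar>x $ 3 - y $ 3\<bar>"
  have \<epsilon>: "\<epsilon> = 1 \<or> \<epsilon> = - 1" "\<theta> \<ge> 0" "x $ 3 - \<epsilon> * \<theta> = y $ 3"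
    by (auto simp: \<epsilon>_def \<theta>_def)
  have "cc_connected k x (vector [0, 0, x $ 3])"
    by (rule cc_connected_origin)
  also have "cc_connected k (vector [0, 0, x $ 3]) (vector [1, 0, x $ 3])"
    using cc_connected_origin(2)[of k "vector [1, 0, x $ 3]"] by simp
  also have "cc_connected k (vector [1, 0, x $ 3]) (vector [cos \<theta>, \<epsilon> * sin \<theta>, y $ 3])"
    using cc_connected_circle[OF \<epsilon>(1,2), of k "x $ 3"] unfolding \<epsilon>(3) .
  also have "cc_connected k \<dots> (vector [0, 0, y $ 3])"
    using cc_connected_origin(1)[of k "vector [cos \<theta>, \<epsilon> * sin \<theta>, y $ 3]"] by simp
  also have "cc_connected k \<dots> y"
    by (rule cc_connected_origin)
  finally show ?thesis .
qed

section \<open>Positivity of the distance\<close>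

text \<open>Connectivity makes the set of durations nonempty; without that its \<open>Inf\<close>
  would carry no information.\<close>

lemma cc_dist_lessE:
  assumes "cc_dist k x y < T"
  obtains \<tau> \<gamma> where "cc_curve k \<tau> \<gamma>" "\<gamma> 0 = x" "\<gamma> \<tau> = y" "\<tau> < T"
proof -
  have "{\<tau>. \<exists>\<gamma>. cc_curve k \<tau> \<gamma> \<and> \<gamma> 0 = x \<and> \<gamma> \<tau> = y} \<noteq> {}"
    using cc_connected[of k x y] unfolding cc_connected_def by blast
  from cInf_lessD[OF this assms[unfolded cc_dist_eq_Inf_cc_curve]] show thesis
    using that by blast
qed

lemma cc_dist_nonneg: "cc_dist k x y \<ge> 0"
proof (rule ccontr)
  assume "\<not> cc_dist k x y \<ge> 0"
  then have "cc_dist k x y < 0"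
    by simp
  then show False
    by (rule cc_dist_lessE) (simp add: cc_curve_def)
qed

text \<open>Curves of duration at most 1 from \<open>x\<close> share one Lipschitz constant, so
  arbitrarily short ones end arbitrarily close to \<open>x\<close>.\<close>

lemma cc_dist_eq_0_imp_eq:
  assumes "cc_dist k x y = 0"
  shows "x = y"
proof -
  define L where "L = cc_speed_bound k (norm x + 1)"
  have L: "L \<ge> 0"
    by (simp add: L_def cc_speed_bound_nonneg)
  have "dist x y \<le> e" if "e > 0" for e
  proof -
    \<comment> \<open>The bound 1 keeps the speed below \<open>L\<close>; the other makes the length
      estimate \<open>(L + 1) * T\<close> at most \<open>e\<close>.\<close>
    define T where "T = min 1 (e / (L + 1))"
    have T: "T > 0" "T \<le> 1" "T \<le> e / (L + 1)"
      using \<open>e > 0\<close> L by (auto simp: T_def)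
    then have "cc_dist k x y < T"
      using assms by simp
    then obtain \<tau> \<gamma> where \<gamma>: "cc_curve k \<tau> \<gamma>" "\<gamma> 0 = x" "\<gamma> \<tau> = y" "\<tau> < T"
      by (rule cc_dist_lessE)
    have \<tau>: "0 \<le> \<tau>"
      using \<gamma>(1) by (simp add: cc_curve_def)
    have "dist (\<gamma> 0) (\<gamma> \<tau>) \<le> cc_speed_bound k (norm (\<gamma> 0) + \<tau>) * dist 0 \<tau>"
      using cc_curve_lipschitz[OF \<gamma>(1)] by (rule lipschitz_onD) (use \<tau> in auto)
    also have "\<dots> \<le> (L + 1) * T"
    proof (rule mult_mono)
      have "cc_speed_bound k (norm (\<gamma> 0) + \<tau>) \<le> L"
        unfolding L_def using \<tau> \<gamma> T by (intro cc_speed_bound_mono) auto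
      then show "cc_speed_bound k (norm (\<gamma> 0) + \<tau>) \<le> L + 1"
        by simp
    qed (use \<tau> \<gamma>(4) L in auto)
    also have "\<dots> \<le> e"
      using T(3) L by (simp add: pos_le_divide_eq mult.commute)
    finally show ?thesis
      using \<gamma> by simp
  qed
  then have "dist x y \<le> 0"
    by (rule field_le_epsilon[where y = 0, simplified])
  then show ?thesis
    by simp
qed

section \<open>The Taylor estimate\<close>

lemma differentiable_local_lipschitz:
  assumes "h differentiable (at p)"
  obtains B d where "d > 0" "B \<ge> 0" "\<And>q. norm (q - p) < d \<Longrightarrow> norm (h q - h p) \<le> B * norm (q - p)"
proof -
  obtain D where D: "(h has_derivative D) (at p)"
    using assms unfolding differentiable_def by blast
  then obtain d where d: "d > 0"
    "\<And>q. norm (q - p) < d \<Longrightarrow> norm (h q - h p - D (q - p)) \<le> 1 * norm (q - p)"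
    unfolding has_derivative_at_alt by (metis zero_less_one)
  obtain K where K: "K > 0" "\<And>x. norm (D x) \<le> norm x * K"
    using has_derivative_bounded_linear[OF D] bounded_linear.pos_bounded by blast
  have "norm (h q - h p) \<le> (K + 1) * norm (q - p)" if "norm (q - p) < d" for q
  proof -
    have "norm (h q - h p) \<le> norm (h q - h p - D (q - p)) + norm (D (q - p))"
      using norm_triangle_sub[of "h q - h p" "D (q - p)"] by simp
    also have "\<dots> \<le> 1 * norm (q - p) + norm (q - p) * K"
      by (intro add_mono d(2) K(2) that)
    finally show ?thesis
      by (simp add: algebra_simps)
  qed
  then show thesis
    using that[of d "K + 1"] d(1) K(1) by simp
qed

text \<open>Off the null set the chain rule expresses the derivative of
  \<open>h \<circ> \<gamma>\<close> through the horizontal derivatives of \<open>h\<close>, with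
  coefficients of modulus at most 1. At every time, differentiability of \<open>h\<close> at the
  single point \<open>\<gamma> s\<close> and the Lipschitz bound for \<open>\<gamma>\<close> give
  the pointwise Lipschitz condition.\<close>

lemma cc_curve_mean_value_bound:
  fixes h :: "real ^ 3 \<Rightarrow> 'b::real_normed_vector"
  assumes \<gamma>: "cc_curve k \<tau> \<gamma>" and h: "\<And>p. h differentiable (at p)"
    and K: "\<And>s. s \<in> {0..\<tau>} \<Longrightarrow> norm (vf_deriv (X1 k) h (\<gamma> s)) + norm (vf_deriv (X2 k) h (\<gamma> s)) \<le> K"
  shows "norm (h (\<gamma> \<tau>) - h (\<gamma> 0)) \<le> K * \<tau>"
proof -
  have \<tau>: "0 \<le> \<tau>"
    using \<gamma> by (simp add: cc_curve_def)
  obtain N where N: "negligible N"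
    "\<And>s. s \<in> {0..\<tau>} - N \<Longrightarrow> \<exists>v. (\<gamma> has_vector_derivative v) (at s) \<and> unit_horizontal k (\<gamma> s) v"
    by (rule cc_curveE[OF \<gamma>]) blast
  obtain L where L: "L-lipschitz_on {0..\<tau>} \<gamma>" "L \<ge> 0"
    using cc_curve_lipschitz[OF \<gamma>] lipschitz_on_nonneg by blast
  have "norm ((h \<circ> \<gamma>) \<tau> - (h \<circ> \<gamma>) 0) \<le> K * (\<tau> - 0)"
  proof (rule mean_value_bound_pointwise_lipschitz[OF \<tau> N(1)])
    fix s
    assume s: "s \<in> {0..\<tau>} - N"
    then obtain v where v: "(\<gamma> has_vector_derivative v) (at s)" "unit_horizontal k (\<gamma> s) v"
      using N(2) by blast
    obtain c1 c2 where c: "v = c1 *\<^sub>R X1 k (\<gamma> s) + c2 *\<^sub>R X2 k (\<gamma> s)"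
      using v(2) unfolding unit_horizontal_def by blast
    have c_le: "\<bar>c1\<bar> \<le> 1" "\<bar>c2\<bar> \<le> 1"
      using unit_horizontal_component_le[OF v(2)] c by auto
    define D where "D = frechet_derivative h (at (\<gamma> s))"
    have D: "(h has_derivative D) (at (\<gamma> s))"
      using h unfolding D_def by (simp add: frechet_derivative_works[symmetric])
    then have lin: "linear D"
      by (rule has_derivative_linear)
    have "((h \<circ> \<gamma>) has_vector_derivative D v) (at s)"
      using vector_derivative_diff_chain_within[OF v(1), of h D] has_derivative_at_withinI[OF D] by blast
    moreover have "D v = c1 *\<^sub>R vf_deriv (X1 k) h (\<gamma> s) + c2 *\<^sub>R vf_deriv (X2 k) h (\<gamma> s)"
      by (simp add: c vf_deriv_def D_def[symmetric] linear_add[OF lin] linear_scale[OF lin])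
    moreover have "norm (c1 *\<^sub>R vf_deriv (X1 k) h (\<gamma> s) + c2 *\<^sub>R vf_deriv (X2 k) h (\<gamma> s)) \<le> K"
    proof -
      have "norm (c1 *\<^sub>R vf_deriv (X1 k) h (\<gamma> s) + c2 *\<^sub>R vf_deriv (X2 k) h (\<gamma> s))
          \<le> \<bar>c1\<bar> * norm (vf_deriv (X1 k) h (\<gamma> s)) + \<bar>c2\<bar> * norm (vf_deriv (X2 k) h (\<gamma> s))"
        by (rule order_trans[OF norm_triangle_ineq]) simp
      also have "\<dots> \<le> norm (vf_deriv (X1 k) h (\<gamma> s)) + norm (vf_deriv (X2 k) h (\<gamma> s))"
        using c_le by (intro add_mono mult_left_le_one_le) auto
      finally show ?thesis
        using K[of s] s by simp
    qed
    ultimately show "\<exists>v. ((h \<circ> \<gamma>) has_vector_derivative v) (at s) \<and> norm v \<le> K"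
      by auto
  next
    fix s
    assume s: "s \<in> {0..\<tau>}"
    obtain B d where B: "d > 0" "B \<ge> 0"
      "\<And>q. norm (q - \<gamma> s) < d \<Longrightarrow> norm (h q - h (\<gamma> s)) \<le> B * norm (q - \<gamma> s)"
      by (rule differentiable_local_lipschitz[OF h[of "\<gamma> s"]]) blast
    \<comment> \<open>The radius \<open>d / (L + 1)\<close> keeps \<open>\<gamma> u\<close> within
      the distance \<open>d\<close> of \<open>\<gamma> s\<close> at which the bound with
      \<open>B\<close> holds.\<close>
    have "norm (h (\<gamma> u) - h (\<gamma> s)) \<le> B * L * \<bar>u - s\<bar>" if u: "u \<in> {0..\<tau>}" "\<bar>u - s\<bar> < d / (L + 1)" for u
    proof -
      have lip: "norm (\<gamma> u - \<gamma> s) \<le> L * \<bar>u - s\<bar>"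
        using lipschitz_onD[OF L(1) u(1) s] by (simp add: dist_norm)
      also have "\<dots> \<le> (L + 1) * \<bar>u - s\<bar>"
        by (simp add: mult_right_mono)
      also have "\<dots> < d"
        using u(2) L(2) pos_less_divide_eq[of "L + 1" "\<bar>u - s\<bar>" d] by (simp add: mult.commute)
      finally have "norm (h (\<gamma> u) - h (\<gamma> s)) \<le> B * norm (\<gamma> u - \<gamma> s)"
        by (rule B(3))
      also have "\<dots> \<le> B * (L * \<bar>u - s\<bar>)"
        using lip B(2) by (rule mult_left_mono)
      finally show ?thesis
        by (simp add: mult.assoc)
    qed
    then show "\<exists>B. \<exists>d>0. \<forall>u\<in>{0..\<tau>}. \<bar>u - s\<bar> < d \<longrightarrow>
        norm ((h \<circ> \<gamma>) u - (h \<circ> \<gamma>) s) \<le> B * \<bar>u - s\<bar>"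
      using B(1) L(2) by (intro exI[of _ "B * L"] exI[of _ "d / (L + 1)"]) auto
  qed
  then show ?thesis
    by simp
qed

section \<open>Differentiability of the horizontal derivatives\<close>

lemma X1_differentiable: "X1 k differentiable (at p)"
  and X2_differentiable: "X2 k differentiable (at p)"
proof -
  have "X1 k = (\<lambda>p. axis 1 1 + (p $ 2 * ((p $ 1)\<^sup>2 + (p $ 2)\<^sup>2) ^ (k - 1)) *\<^sub>R axis 3 1)"
    and "X2 k = (\<lambda>p. axis 2 1 + (- (p $ 1) * ((p $ 1)\<^sup>2 + (p $ 2)\<^sup>2) ^ (k - 1)) *\<^sub>R axis 3 1)"
    by (auto simp: fun_eq_iff vec_eq_iff forall_3 axis_def)
  moreover have "(\<lambda>p :: real ^ 3. p $ i) differentiable (at p)" for i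
    by (intro bounded_linear_imp_differentiable bounded_linear_vec_nth)
  ultimately show "X1 k differentiable (at p)" "X2 k differentiable (at p)"
    by (auto intro!: differentiable_add differentiable_mult differentiable_scaleR differentiable_power
        differentiable_minus)
qed

lemma twice_differentiable_imp_differentiable:
  "twice_differentiable f \<Longrightarrow> f differentiable (at p)"
  unfolding twice_differentiable_def differentiable_def by blast

text \<open>\<open>vf_deriv X f\<close> is the operator \<open>f' p\<close> applied to the vector
  \<open>X p\<close>, so the product rule for this bounded bilinear pairing applies.\<close>

lemma vf_deriv_differentiable:
  fixes f :: "real ^ 3 \<Rightarrow> 'b::real_normed_vector"
  assumes "twice_differentiable f" "X differentiable (at p)"
  shows "vf_deriv X f differentiable (at p)"
proof -
  obtain f' :: "real ^ 3 \<Rightarrow> (real ^ 3) \<Rightarrow>\<^sub>L 'b" where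
    f': "\<And>x. (f has_derivative blinfun_apply (f' x)) (at x)" "\<And>x. f' differentiable (at x)"
    using assms(1) unfolding twice_differentiable_def by blast
  have *: "vf_deriv X f = (\<lambda>p. blinfun_apply (f' p) (X p))"
    using frechet_derivative_at[OF f'(1)] by (simp add: fun_eq_iff vf_deriv_def)
  obtain A B where "(f' has_derivative A) (at p)" "(X has_derivative B) (at p)"
    using f'(2) assms(2) unfolding differentiable_def by blast
  from bounded_bilinear.FDERIV[OF bounded_bilinear_blinfun_apply this] show ?thesis
    unfolding * differentiable_def by blast
qed

text \<open>For \<open>X1\<close> and \<open>X2\<close>, whose planar components are constants 0 and
  1, the correction merely shifts the horizontal derivatives by \<open>a\<close> and
  \<open>b\<close>.\<close>

lemma vf_deriv_diff_planar_linear: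
  fixes f :: "real ^ 3 \<Rightarrow> 'b::real_normed_vector"
  assumes "f differentiable (at p)"
  shows "(\<lambda>q. f q - q $ 1 *\<^sub>R a - q $ 2 *\<^sub>R b) differentiable (at p)"
    and "vf_deriv X (\<lambda>q. f q - q $ 1 *\<^sub>R a - q $ 2 *\<^sub>R b) p = vf_deriv X f p - X p $ 1 *\<^sub>R a - X p $ 2 *\<^sub>R b"
proof -
  have D: "((\<lambda>q. f q - q $ 1 *\<^sub>R a - q $ 2 *\<^sub>R b) has_derivative
      (\<lambda>h. frechet_derivative f (at p) h - h $ 1 *\<^sub>R a - h $ 2 *\<^sub>R b)) (at p)"
    using assms unfolding frechet_derivative_works
    by (intro has_derivative_diff has_derivative_scaleR_left
        bounded_linear_imp_has_derivative bounded_linear_vec_nth)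
  then show "(\<lambda>q. f q - q $ 1 *\<^sub>R a - q $ 2 *\<^sub>R b) differentiable (at p)"
    by (auto simp: differentiable_def)
  show "vf_deriv X (\<lambda>q. f q - q $ 1 *\<^sub>R a - q $ 2 *\<^sub>R b) p = vf_deriv X f p - X p $ 1 *\<^sub>R a - X p $ 2 *\<^sub>R b"
    by (simp add: vf_deriv_def frechet_derivative_at[OF D, symmetric])
qed

lemma horizontal_taylor_along_cc_curve:
  fixes f :: "real ^ 3 \<Rightarrow> 'b::real_normed_vector"
  assumes \<gamma>: "cc_curve k \<tau> \<gamma>" and f: "twice_differentiable f"
    and M: "\<And>s Xi Xj. s \<in> {0..\<tau>} \<Longrightarrow> Xi \<in> {X1 k, X2 k} \<Longrightarrow> Xj \<in> {X1 k, X2 k} \<Longrightarrow>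
      norm (vf_deriv Xi (vf_deriv Xj f) (\<gamma> s)) \<le> M"
  shows "norm (f (\<gamma> \<tau>) - horizontal_taylor k f (\<gamma> 0) (\<gamma> \<tau> - \<gamma> 0)) \<le> 4 * M * \<tau>\<^sup>2"
proof -
  have \<tau>: "0 \<le> \<tau>"
    using \<gamma> by (simp add: cc_curve_def)
  have "M \<ge> 0"
    using M[of 0 "X1 k" "X1 k"] \<tau> by (auto intro: order_trans[OF norm_ge_zero])
  have first: "norm (vf_deriv X f (\<gamma> s) - vf_deriv X f (\<gamma> 0)) \<le> 2 * M * \<tau>"
    if "X \<in> {X1 k, X2 k}" "s \<in> {0..\<tau>}" for X s
  proof -
    have "norm (vf_deriv X f (\<gamma> s) - vf_deriv X f (\<gamma> 0)) \<le> (M + M) * s"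
    proof (rule cc_curve_mean_value_bound)
      show "cc_curve k s \<gamma>"
        using cc_curve_initial_segment[OF \<gamma>] that(2) by simp
      show "vf_deriv X f differentiable (at p)" for p
        using that(1) X1_differentiable X2_differentiable by (blast intro: vf_deriv_differentiable[OF f])
      show "norm (vf_deriv (X1 k) (vf_deriv X f) (\<gamma> u)) + norm (vf_deriv (X2 k) (vf_deriv X f) (\<gamma> u)) \<le> M + M"
        if "u \<in> {0..s}" for u
        using that \<open>X \<in> _\<close> \<open>s \<in> _\<close> by (intro add_mono M) auto
    qed
    also have "\<dots> \<le> 2 * M * \<tau>"
      using that(2) \<open>M \<ge> 0\<close> by (simp add: mult_left_mono)
    finally show ?thesis .
  qed
  define a where "a = vf_deriv (X1 k) f (\<gamma> 0)"
  define b where "b = vf_deriv (X2 k) f (\<gamma> 0)"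
  \<comment> \<open>The horizontal derivatives of \<open>g\<close> vanish at
    \<open>\<gamma> 0\<close>, and its increment along the curve is exactly the Taylor
    remainder.\<close>
  define g where "g = (\<lambda>q. f q - q $ 1 *\<^sub>R a - q $ 2 *\<^sub>R b)"
  have g: "g differentiable (at p)"
    "vf_deriv (X1 k) g p = vf_deriv (X1 k) f p - a" "vf_deriv (X2 k) g p = vf_deriv (X2 k) f p - b" for p
    unfolding g_def using vf_deriv_diff_planar_linear[OF twice_differentiable_imp_differentiable[OF f]]
    by simp_all
  have "norm (g (\<gamma> \<tau>) - g (\<gamma> 0)) \<le> (2 * M * \<tau> + 2 * M * \<tau>) * \<tau>"
  proof (rule cc_curve_mean_value_bound[OF \<gamma> g(1)])
    show "norm (vf_deriv (X1 k) g (\<gamma> s)) + norm (vf_deriv (X2 k) g (\<gamma> s)) \<le> 2 * M * \<tau> + 2 * M * \<tau>"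
      if "s \<in> {0..\<tau>}" for s
      unfolding g(2,3) a_def b_def using that by (intro add_mono first) auto
  qed
  moreover have "f (\<gamma> \<tau>) - horizontal_taylor k f (\<gamma> 0) (\<gamma> \<tau> - \<gamma> 0) = g (\<gamma> \<tau>) - g (\<gamma> 0)"
    by (simp add: horizontal_taylor_def g_def a_def b_def algebra_simps)
  moreover have "(2 * M * \<tau> + 2 * M * \<tau>) * \<tau> = 4 * M * \<tau>\<^sup>2"
    by (simp add: power2_eq_square)
  ultimately show ?thesis
    by (simp only:)
qed

theorem theorem1p2:
  fixes k :: nat
  assumes "k \<ge> 2"
  shows "\<exists>c>0. \<exists>C>0. \<forall>f :: real ^ 3 \<Rightarrow> complex. twice_differentiable f \<longrightarrow>
    (\<forall>x y. ereal (norm (f y - horizontal_taylor k f x (y - x)))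
       \<le> ereal (C * (cc_dist k x y)\<^sup>2) *
         (SUP (z, Xi, Xj) \<in> {z. cc_dist k x z \<le> c * cc_dist k x y} \<times> {X1 k, X2 k} \<times> {X1 k, X2 k}.
            ereal (norm (vf_deriv Xi (vf_deriv Xj f) z))))"
proof (rule exI[of _ 2], rule conjI, simp, rule exI[of _ 16], rule conjI, simp, intro allI impI)
  \<comment> \<open>The factor 2 in the radius leaves room for a curve of duration below
    \<open>2 * d\<close>, since the infimum need not be attained a priori; 16 arises from
    \<open>4 * M * \<tau>\<^sup>2\<close> with \<open>\<tau> < 2 * d\<close>.\<close>
  fix f :: "real ^ 3 \<Rightarrow> complex" and x y :: "real ^ 3"
  assume f: "twice_differentiable f"
  define d where "d = cc_dist k x y"
  define I where "I = {z. cc_dist k x z \<le> 2 * d} \<times> {X1 k, X2 k} \<times> {X1 k, X2 k}"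
  define F where "F = (\<lambda>(z, Xi, Xj). ereal (norm (vf_deriv Xi (vf_deriv Xj f) z)))"
  define S where "S = (SUP q \<in> I. F q)"
  have "ereal (norm (f y - horizontal_taylor k f x (y - x))) \<le> ereal (16 * d\<^sup>2) * S"
  proof (cases "d = 0")
    \<comment> \<open>No duration lies below \<open>2 * d\<close> here. The points coincide, the
      remainder is 0, and so is the right-hand side, even for infinite \<open>S\<close>, because
      \<open>0 * \<infinity> = 0\<close> in \<open>ereal\<close>.\<close>
    case True
    then have "x = y"
      unfolding d_def by (rule cc_dist_eq_0_imp_eq)
    then show ?thesis
      using True by (simp add: horizontal_taylor_def zero_ereal_def[symmetric])
  next
    case False
    then have "d > 0"
      using cc_dist_nonneg[of k x y] by (simp add: d_def)
    then have "cc_dist k x y < 2 * d"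
      by (simp add: d_def)
    then obtain \<tau> \<gamma> where \<gamma>: "cc_curve k \<tau> \<gamma>" "\<gamma> 0 = x" "\<gamma> \<tau> = y" "\<tau> < 2 * d"
      by (rule cc_dist_lessE)
    have \<tau>: "0 \<le> \<tau>"
      using \<gamma>(1) by (simp add: cc_curve_def)
    have le_S: "ereal (norm (vf_deriv Xi (vf_deriv Xj f) (\<gamma> s))) \<le> S"
      if "s \<in> {0..\<tau>}" "Xi \<in> {X1 k, X2 k}" "Xj \<in> {X1 k, X2 k}" for s Xi Xj
    proof -
      have "cc_dist k (\<gamma> 0) (\<gamma> s) \<le> s"
        using cc_dist_le cc_curve_initial_segment[OF \<gamma>(1)] that(1) by simp
      then have "(\<gamma> s, Xi, Xj) \<in> I"
        using that \<gamma>(2,4) unfolding I_def by auto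
      then have "F (\<gamma> s, Xi, Xj) \<le> S"
        unfolding S_def by (rule SUP_upper)
      then show ?thesis
        by (simp add: F_def)
    qed
    have "S \<ge> 0"
      using le_S[of 0 "X1 k" "X1 k"] \<tau> by (auto intro: order_trans[rotated])
    show ?thesis
    \<comment> \<open>The supremum is extended real: an infinite one makes the right-hand side
      infinite because \<open>d > 0\<close>, and \<open>S \<ge> 0\<close> excludes the value minus
      infinity.\<close>
    proof (cases S)
      case (real M)
      then have M: "M \<ge> 0"
        using \<open>S \<ge> 0\<close> by simp
      have "norm (f (\<gamma> \<tau>) - horizontal_taylor k f (\<gamma> 0) (\<gamma> \<tau> - \<gamma> 0)) \<le> 4 * M * \<tau>\<^sup>2"
        using le_S unfolding real by (intro horizontal_taylor_along_cc_curve[OF \<gamma>(1) f]) auto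
      also have "\<dots> \<le> 4 * M * (2 * d)\<^sup>2"
        using M \<tau> \<gamma>(4) by (intro mult_left_mono power_mono) auto
      finally show ?thesis
        using \<gamma> by (simp add: real power_mult_distrib algebra_simps)
    next
      case PInf
      then show ?thesis
        using \<open>d > 0\<close> by simp
    next
      case MInf
      then show ?thesis
        using \<open>S \<ge> 0\<close> by simp
    qed
  qed
  then show "ereal (norm (f y - horizontal_taylor k f x (y - x)))
       \<le> ereal (16 * (cc_dist k x y)\<^sup>2) *
         (SUP (z, Xi, Xj) \<in> {z. cc_dist k x z \<le> 2 * cc_dist k x y} \<times> {X1 k, X2 k} \<times> {X1 k, X2 k}.
            ereal (norm (vf_deriv Xi (vf_deriv Xj f) z)))"
    by (simp only: S_def I_def F_def d_def)
qed

end
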